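(* The subcubic outerplanar graph $H$ defined in the context is not packing $(1,1,3,4)$-colorable.
   Context: A graph is subcubic if its maximum degree is at most $3$. For a non-decreasing sequence $S=(s_1,\dots,s_k)$ of positive integers, a packing $S$-coloring of a graph $G$ is a partition of $V(G)$ into sets $V_1,\dots,V_k$ (some possibly empty) such that, for each $1\le i\le k$, the distance in $G$ between any two distinct vertices $x,y\in V_i$ is at least $s_i+1$. $G$ is packing $S$-colorable if it has a packing $S$-coloring. Construction of $H$. Let $B$ be the graph on $9$ vertices consisting of three disjoint triangles $b_1b_2b_3$, $c_1c_2c_3$, $d_1d_2d_3$ together with the two edges $b_2c_1$ and $b_3d_1$; call $b_1$ its root. Gadget $G_3$ (on $21$ vertices) consists of a triangle $u_1u_2u_3$ and two disjoint copies of $B$, with $u_2$ joined by an edge to the root of one copy and $u_3$ joined by an edge to the root of the other copy; call $u_1$ the root of $G_3$. The graph $H$ consists of a triangle $v_1v_2v_3$ and three disjoint copies of $G_3$, one for each $i\in\{1,2,3\}$, with $v_i$ joined by an edge to the root of the $i$-th copy. *)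

theory Defs
  imports "HOL-Analysis.Analysis" "Graph_Theory.Pair_Digraph" "Graph_Theory.Shortest_Path"
begin

text \<open>
  A finite simple graph is a symmetric loop-free digraph without parallel arcs, that is,
  an instance of the locale \<open>pair_graph\<close>: the edge \<open>xy\<close> is the pair of arcs \<open>(x, y)\<close>, \<open>(y, x)\<close>.
\<close>

subsection \<open>Subcubic graphs\<close>

text \<open>In a symmetric digraph the out-degree is the degree of the underlying undirected graph.\<close>

definition subcubic :: "'a pair_pre_digraph \<Rightarrow> bool" where
  "subcubic G \<longleftrightarrow> (\<forall>v \<in> pverts G. out_degree (with_proj G) v \<le> 3)"

subsection \<open>Outerplanar graphs\<close>

definition uedges :: "'a pair_pre_digraph \<Rightarrow> 'a set set" where
  "uedges G = (\<lambda>(x, y). {x, y}) ` parcs G"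

definition plane_drawing ::
  "'a pair_pre_digraph \<Rightarrow> ('a \<Rightarrow> complex) \<Rightarrow> ('a set \<Rightarrow> real \<Rightarrow> complex) \<Rightarrow> bool" where
  "plane_drawing G p \<gamma> \<longleftrightarrow>
     inj_on p (pverts G) \<and>
     (\<forall>e \<in> uedges G. arc (\<gamma> e) \<and> {pathstart (\<gamma> e), pathfinish (\<gamma> e)} = p ` e \<and>
        path_image (\<gamma> e) \<inter> p ` pverts G = p ` e) \<and>
     (\<forall>e \<in> uedges G. \<forall>f \<in> uedges G. e \<noteq> f \<longrightarrow>
        path_image (\<gamma> e) \<inter> path_image (\<gamma> f) \<subseteq> p ` (e \<inter> f))"

definition drawing_image ::
  "'a pair_pre_digraph \<Rightarrow> ('a \<Rightarrow> complex) \<Rightarrow> ('a set \<Rightarrow> real \<Rightarrow> complex) \<Rightarrow> complex set" where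
  "drawing_image G p \<gamma> = p ` pverts G \<union> (\<Union>e \<in> uedges G. path_image (\<gamma> e))"

text \<open>
  The drawing of a finite graph is compact, so \<open>outside\<close> of it is its unique unbounded face.
\<close>

definition outerplanar :: "'a pair_pre_digraph \<Rightarrow> bool" where
  "outerplanar G \<longleftrightarrow>
     (\<exists>p \<gamma>. plane_drawing G p \<gamma> \<and> p ` pverts G \<subseteq> frontier (outside (drawing_image G p \<gamma>)))"

subsection \<open>Packing colorings\<close>

text \<open>
  Distance is \<^term>\<open>wf_digraph.\<mu>\<close> for unit weights; it is \<open>\<infinity>\<close> between different components.
  The sequence \<open>S = (s\<^sub>1, \<dots>, s\<^sub>k)\<close>, understood to be non-decreasing with positive entries, is a list;
  the class written \<open>V\<^sub>i\<close> in one-based numbering is \<open>V (i - 1)\<close>.  Classes may be empty.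
\<close>

definition graph_dist :: "'a pair_pre_digraph \<Rightarrow> 'a \<Rightarrow> 'a \<Rightarrow> ereal" where
  "graph_dist G = wf_digraph.\<mu> (with_proj G) (\<lambda>_. 1)"

definition packing_coloring :: "nat list \<Rightarrow> 'a pair_pre_digraph \<Rightarrow> (nat \<Rightarrow> 'a set) \<Rightarrow> bool" where
  "packing_coloring S G V \<longleftrightarrow>
     (\<Union>i < length S. V i) = pverts G \<and>
     disjoint_family_on V {..<length S} \<and>
     (\<forall>i < length S. \<forall>x \<in> V i. \<forall>y \<in> V i. x \<noteq> y \<longrightarrow> ereal (real (S ! i + 1)) \<le> graph_dist G x y)"

definition packing_colorable :: "nat list \<Rightarrow> 'a pair_pre_digraph \<Rightarrow> bool" where
  "packing_colorable S G \<longleftrightarrow> (\<exists>V. packing_coloring S G V)"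

subsection \<open>The graph \<open>H\<close>\<close>

datatype three = One | Two | Three

definition edge :: "'a \<Rightarrow> 'a \<Rightarrow> 'a rel" where
  "edge x y = {(x, y), (y, x)}"

definition triangle :: "(three \<Rightarrow> 'a) \<Rightarrow> 'a rel" where
  "triangle t = edge (t One) (t Two) \<union> edge (t Two) (t Three) \<union> edge (t One) (t Three)"

datatype B_vertex = Bb three | Bc three | Bd three

definition B_arcs :: "B_vertex rel" where
  "B_arcs = triangle Bb \<union> triangle Bc \<union> triangle Bd \<union>
     edge (Bb Two) (Bc One) \<union> edge (Bb Three) (Bd One)"

text \<open>\<open>BTwo\<close> and \<open>BThree\<close> embed the copies of \<open>B\<close> attached to \<open>u\<^sub>2\<close> and \<open>u\<^sub>3\<close>.\<close>

datatype G3_vertex = U three | BTwo B_vertex | BThree B_vertex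

definition G3_arcs :: "G3_vertex rel" where
  "G3_arcs = triangle U \<union>
     map_prod BTwo BTwo ` B_arcs \<union> map_prod BThree BThree ` B_arcs \<union>
     edge (U Two) (BTwo (Bb One)) \<union> edge (U Three) (BThree (Bb One))"

datatype H_vertex = Center three | Copy three G3_vertex

definition H_arcs :: "H_vertex rel" where
  "H_arcs = triangle Center \<union>
     (\<Union>i. map_prod (Copy i) (Copy i) ` G3_arcs) \<union>
     (\<Union>i. edge (Center i) (Copy i (U One)))"

definition H :: "H_vertex pair_pre_digraph" where
  "H = \<lparr>pverts = UNIV, parcs = H_arcs\<rparr>"

lemma UNIV_three: "(UNIV :: three set) = {One, Two, Three}"
  using three.exhaust by auto

lemma UNIV_B_vertex: "(UNIV :: B_vertex set) = range Bb \<union> range Bc \<union> range Bd"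
proof -
  have "x \<in> range Bb \<union> range Bc \<union> range Bd" for x
    by (cases x) blast+
  then show ?thesis by blast
qed

lemma UNIV_G3_vertex: "(UNIV :: G3_vertex set) = range U \<union> range BTwo \<union> range BThree"
proof -
  have "x \<in> range U \<union> range BTwo \<union> range BThree" for x
    by (cases x) blast+
  then show ?thesis by blast
qed

lemma UNIV_H_vertex: "(UNIV :: H_vertex set) = range Center \<union> (\<Union>i. range (Copy i))"
proof -
  have "x \<in> range Center \<union> (\<Union>i. range (Copy i))" for x
    by (cases x) blast+
  then show ?thesis by blast
qed

lemma finite_UNIV_H_vertex: "finite (UNIV :: H_vertex set)"
  by (simp add: UNIV_H_vertex UNIV_G3_vertex UNIV_B_vertex UNIV_three)

lemma sym_edge: "sym (edge x y)"
  by (auto simp: edge_def sym_def)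

lemma sym_map_prod: "sym R \<Longrightarrow> sym (map_prod f f ` R)"
  unfolding sym_def by (auto 0 3 intro: rev_image_eqI)

lemma sym_H_arcs: "sym H_arcs"
  unfolding H_arcs_def G3_arcs_def B_arcs_def triangle_def
  by (intro sym_Un sym_UNION ballI sym_map_prod sym_edge)

lemma irrefl_H_arcs: "irrefl H_arcs"
  by (auto simp: irrefl_def H_arcs_def G3_arcs_def B_arcs_def triangle_def edge_def)

lemma pair_graph_H: "pair_graph H"
proof
  show "finite (pverts H)"
    by (simp add: H_def finite_UNIV_H_vertex)
  show "finite (parcs H)"
    by (rule finite_subset[OF subset_UNIV], subst UNIV_Times_UNIV[symmetric])
      (intro finite_cartesian_product finite_UNIV_H_vertex)
  show "symmetric (with_proj H)"
    using sym_H_arcs by (simp add: symmetric_def H_def)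
  show "fst e \<noteq> snd e" if "e \<in> parcs H" for e
    using that irrefl_H_arcs by (cases e) (auto simp: H_def irrefl_def)
qed (simp_all add: H_def)

lemma card_H: "card (pverts H) = 66"
  by (simp add: H_def UNIV_H_vertex UNIV_G3_vertex UNIV_B_vertex UNIV_three)

end

theory Submission
  imports Defs
begin

text \<open>
  Outerplanarity: a graph whose vertices are placed on a parabola so that no two edges cross as chords
  is drawn inside the convex region above the parabola, and everything below it is in the outer face.

  Coloring: the classes \<open>V\<^sub>1\<close> and \<open>V\<^sub>2\<close> are independent, so every triangle meets \<open>A \<union> C\<close> with
  \<open>A = V\<^sub>3\<close>, \<open>C = V\<^sub>4\<close>. Points of \<open>A\<close> are at distance at least 4 and points of \<open>C\<close> at distance at
  least 5.  If the triangle \<open>b\<close> of a copy of \<open>B\<close> meets \<open>A\<close>, then its triangle \<open>c\<close> meets \<open>C\<close>, so \<open>C\<close>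
  always comes within distance 4 of the vertex to which the copy is attached, which is
  therefore not in \<open>C\<close>.  Hence in each copy of \<open>G\<^sub>3\<close> either the root is in \<open>C\<close>, or the triangle \<open>u\<close>
  meets \<open>A\<close> and, the adjacent triangles \<open>b\<close> then avoiding \<open>A\<close>, some point of \<open>C\<close> is within distance 3 of the root.
  Now consider the triangle \<open>v\<close>: a point \<open>v\<^sub>i \<in> C\<close> is too close to the point of \<open>C\<close> in the
  \<open>i\<close>-th copy, while a point \<open>v\<^sub>i \<in> A\<close> is too close to every triangle \<open>u\<close>, which forces all three
  roots, pairwise at distance 3, into \<open>C\<close>.
\<close>

subsection \<open>Degrees\<close>

text \<open>Cyclic shift inside a triangle: \<open>rot\<close> and its square name the other two
  vertices uniformly.\<close>

fun rot :: "three \<Rightarrow> three" where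
  "rot One = Two" | "rot Two = Three" | "rot Three = One"

fun rot_B :: "B_vertex \<Rightarrow> B_vertex" where
  "rot_B (Bb t) = Bb (rot t)" | "rot_B (Bc t) = Bc (rot t)" | "rot_B (Bd t) = Bd (rot t)"

fun rot_G3 :: "G3_vertex \<Rightarrow> G3_vertex" where
  "rot_G3 (U t) = U (rot t)"
| "rot_G3 (BTwo b) = BTwo (rot_B b)"
| "rot_G3 (BThree b) = BThree (rot_B b)"

fun rot_H :: "H_vertex \<Rightarrow> H_vertex" where
  "rot_H (Center t) = Center (rot t)"
| "rot_H (Copy i g) = Copy i (rot_G3 g)"

text \<open>A vertex without an edge leaving its triangle is its own mate.\<close>

fun mate_B :: "B_vertex \<Rightarrow> B_vertex" where
  "mate_B (Bb Two) = Bc One" | "mate_B (Bc One) = Bb Two"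
| "mate_B (Bb Three) = Bd One" | "mate_B (Bd One) = Bb Three"
| "mate_B b = b"

fun mate_G3 :: "G3_vertex \<Rightarrow> G3_vertex" where
  "mate_G3 (U Two) = BTwo (Bb One)" | "mate_G3 (BTwo (Bb One)) = U Two"
| "mate_G3 (U Three) = BThree (Bb One)" | "mate_G3 (BThree (Bb One)) = U Three"
| "mate_G3 (U One) = U One"
| "mate_G3 (BTwo b) = BTwo (mate_B b)" | "mate_G3 (BThree b) = BThree (mate_B b)"

fun mate_H :: "H_vertex \<Rightarrow> H_vertex" where
  "mate_H (Center i) = Copy i (U One)"
| "mate_H (Copy i (U One)) = Center i"
| "mate_H (Copy i g) = Copy i (mate_G3 g)"

text \<open>Each vertex lies in exactly one of the triangles and on at most one edge outside it, so
  two rotations and the mate exhaust its neighbours.\<close>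

lemma H_arcs_neighbours:
  assumes "(x, y) \<in> H_arcs"
  shows "y \<in> {rot_H x, rot_H (rot_H x), mate_H x}"
  using assms
  by (auto simp: H_arcs_def G3_arcs_def B_arcs_def triangle_def edge_def)

lemma subcubic_H: "subcubic H"
  unfolding subcubic_def
proof
  fix v
  have "out_arcs (with_proj H) v \<subseteq> Pair v ` {rot_H v, rot_H (rot_H v), mate_H v}"
    using H_arcs_neighbours[of v] by (force simp: out_arcs_def H_def)
  then have "card (out_arcs (with_proj H) v) \<le> card (Pair v ` {rot_H v, rot_H (rot_H v), mate_H v})"
    by (intro card_mono) auto
  also have "\<dots> \<le> card {rot_H v, rot_H (rot_H v), mate_H v}"
    by (intro card_image_le) auto
  also have "\<dots> \<le> 3"
    by (simp add: card_insert_if)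
  finally show "out_degree (with_proj H) v \<le> 3"
    by (simp add: out_degree_def)
qed

subsection \<open>Drawing a graph with chords of a parabola\<close>

definition parabola :: "real \<Rightarrow> complex" where
  "parabola t = Complex t (t\<^sup>2)"

lemma parabola_eq_iff [simp]: "parabola s = parabola t \<longleftrightarrow> s = t"
  by (auto simp: parabola_def)

text \<open>On the chord, \<open>Im z\<close> is \<open>(a + b) * Re z - a * b\<close>; the last
  conclusion splits off the height over the parabola.\<close>

lemma chord_coordinates:
  assumes "z \<in> closed_segment (parabola a) (parabola b)" "a < b"
  shows "a \<le> Re z" "Re z \<le> b" "Im z = (Re z)\<^sup>2 + (Re z - a) * (b - Re z)"
proof -
  from assms(1) obtain u where u: "0 \<le> u" "u \<le> 1"
    and z: "z = (1 - u) *\<^sub>R parabola a + u *\<^sub>R parabola b"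
    by (auto simp: in_segment)
  have re: "Re z = a + u * (b - a)" and im: "Im z = (1 - u) * a\<^sup>2 + u * b\<^sup>2"
    by (simp_all add: z parabola_def algebra_simps)
  show "a \<le> Re z"
    using u assms(2) by (simp add: re)
  have "u * (b - a) \<le> 1 * (b - a)"
    using u assms(2) by (intro mult_right_mono) auto
  then show "Re z \<le> b"
    by (simp add: re)
  show "Im z = (Re z)\<^sup>2 + (Re z - a) * (b - Re z)"
    unfolding re im by (simp add: algebra_simps power2_eq_square)
qed

lemma chord_Int_parabola:
  assumes "parabola t \<in> closed_segment (parabola a) (parabola b)" "a < b"
  shows "t = a \<or> t = b"
  using chord_coordinates(3)[OF assms] by (auto simp: parabola_def)

text \<open>
  The height of a chord over the parabola at abscissa \<open>x\<close> is \<open>(x - a) (b - x)\<close>, which is strictly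
  monotone in the interval \<open>[a, b]\<close>; so chords meet only at common endpoints unless they cross.
\<close>

lemma nested_chords:
  fixes a b c d x :: real
  assumes "c \<le> a" "a < b" "b \<le> d" "(a, b) \<noteq> (c, d)" "a \<le> x" "x \<le> b"
    and eq: "(x - a) * (b - x) = (x - c) * (d - x)"
  shows "x \<in> {a, b} \<inter> {c, d}"
proof -
  \<comment> \<open>The interval is widened first at its right end, then at its left; equal heights
    in total force equality at each stage.\<close>
  have le: "(x - a) * (b - x) \<le> (x - a) * (d - x)" "(x - a) * (d - x) \<le> (x - c) * (d - x)"
    using assms(1-3,5,6) by (auto intro!: mult_left_mono mult_right_mono)
  then have "(x - a) * (b - x) = (x - a) * (d - x)" "(x - a) * (d - x) = (x - c) * (d - x)"
    using eq by linarith+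
  then have "x = a \<or> b = d" "x = d \<or> a = c"
    by auto
  then show ?thesis
    using assms by auto
qed

lemma noncrossing_chords:
  assumes z: "z \<in> closed_segment (parabola a) (parabola b)" "z \<in> closed_segment (parabola c) (parabola d)"
    and "a < b" "c < d" "(a, b) \<noteq> (c, d)"
    and nc: "\<not> (a < c \<and> c < b \<and> b < d)" "\<not> (c < a \<and> a < d \<and> d < b)"
  shows "z \<in> parabola ` ({a, b} \<inter> {c, d})"
proof -
  note ab = chord_coordinates[OF z(1) \<open>a < b\<close>] and cd = chord_coordinates[OF z(2) \<open>c < d\<close>]
  define x where "x = Re z"
  have eq: "(x - a) * (b - x) = (x - c) * (d - x)"
    using ab(3) cd(3) by (simp add: x_def)
  have x: "x \<in> {a, b} \<inter> {c, d}"
  proof -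
    \<comment> \<open>Intervals that do not cross are nested or share at most an endpoint.\<close>
    consider "b \<le> c" | "d \<le> a" | "c \<le> a" "b \<le> d" | "a \<le> c" "d \<le> b"
      using nc by linarith
    then show ?thesis
    proof cases
      case 3
      then show ?thesis
        using nested_chords[of c a b d x] ab cd assms eq by (auto simp: x_def)
    next
      case 4
      then show ?thesis
        using nested_chords[of a c d b x] ab cd assms eq by (auto simp: x_def)
    qed (use ab cd in \<open>auto simp: x_def\<close>)
  qed
  moreover have "Im z = x\<^sup>2"
    using ab(3) x by (auto simp: x_def)
  then have "z = parabola x"
    by (simp add: complex_eq_iff parabola_def x_def)
  ultimately show ?thesis by blast
qed

lemma convex_epigraph_square: "convex {z. (Re z)\<^sup>2 \<le> Im z}"
proof (rule convexI)
  fix x y :: complex and u v :: real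
  assume xy: "x \<in> {z. (Re z)\<^sup>2 \<le> Im z}" "y \<in> {z. (Re z)\<^sup>2 \<le> Im z}"
    and uv: "0 \<le> u" "0 \<le> v" "u + v = 1"
  have "convex_on UNIV (\<lambda>x::real. x\<^sup>2)"
    by (rule convex_power2)
  then have "(u * Re x + v * Re y)\<^sup>2 \<le> u * (Re x)\<^sup>2 + v * (Re y)\<^sup>2"
    using uv by (auto simp: convex_on_def)
  also have "\<dots> \<le> u * Im x + v * Im y"
    using xy uv by (intro add_mono mult_left_mono) auto
  finally show "u *\<^sub>R x + v *\<^sub>R y \<in> {z. (Re z)\<^sup>2 \<le> Im z}"
    by simp
qed

text \<open>For symmetric \<open>R\<close> one interleaving pattern covers all, since both
  orientations and both orders of the arcs are quantified over.\<close>

definition noncrossing :: "('a \<Rightarrow> 'b :: linorder) \<Rightarrow> 'a rel \<Rightarrow> bool" where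
  "noncrossing f R \<longleftrightarrow> (\<forall>(a, b)\<in>R. \<forall>(c, d)\<in>R. \<not> (f a < f c \<and> f c < f b \<and> f b < f d))"

lemma outerplanar_if_noncrossing:
  fixes f :: "'a \<Rightarrow> real"
  assumes G: "pair_graph G" and inj: "inj_on f (pverts G)"
    and noncrossing: "noncrossing f (parcs G)"
  shows "outerplanar G"
proof -
  interpret G: pair_graph G by (rule G)
  have nc: "\<not> (f a < f c \<and> f c < f b \<and> f b < f d)"
    if "(a, b) \<in> parcs G" "(c, d) \<in> parcs G" for a b c d
    using noncrossing that unfolding noncrossing_def by blast
  define p where "p x = parabola (f x)" for x
  \<comment> \<open>An edge is an unordered pair; \<open>Min\<close> and \<open>Max\<close> direct
    its chord from left to right.\<close>
  define \<gamma> where "\<gamma> e = linepath (parabola (Min (f ` e))) (parabola (Max (f ` e)))" for e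
  have p_inj: "inj_on p (pverts G)"
    using inj by (auto simp: inj_on_def p_def)
  have edgeE: thesis
    if e: "e \<in> uedges G"
      and *: "\<And>a b. \<lbrakk>(a, b) \<in> parcs G; e = {a, b}; a \<in> pverts G; b \<in> pverts G; f a < f b;
        \<gamma> e = linepath (p a) (p b)\<rbrakk> \<Longrightarrow> thesis"
    for e thesis
  proof -
    obtain a b where ab: "(a, b) \<in> parcs G" "e = {a, b}"
      using e by (auto simp: uedges_def)
    have ba: "(b, a) \<in> parcs G"
      using ab(1) by (simp add: G.arcs_symmetric)
    have verts: "a \<in> pverts G" "b \<in> pverts G"
      using ab(1) by (auto dest: G.wellformed)
    have "a \<noteq> b"
      using ab(1) G.no_loops by fastforce
    then consider "f a < f b" | "f b < f a"
      using inj verts by (metis inj_onD linorder_neqE)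
    then show thesis
    proof cases
      case 1
      then show ?thesis
        using *[of a b] ab verts by (simp add: \<gamma>_def p_def)
    next
      case 2
      then show ?thesis
        using *[of b a] ab ba verts by (simp add: \<gamma>_def p_def insert_commute)
    qed
  qed
  have drawing: "plane_drawing G p \<gamma>"
    unfolding plane_drawing_def
  proof (intro conjI ballI impI p_inj)
    fix e assume "e \<in> uedges G"
    then obtain a b where e: "e = {a, b}" "a \<in> pverts G" "b \<in> pverts G" "f a < f b"
      "\<gamma> e = linepath (p a) (p b)"
      by (rule edgeE)
    show "arc (\<gamma> e)"
      using e by (simp add: p_def)
    show "{pathstart (\<gamma> e), pathfinish (\<gamma> e)} = p ` e"
      using e by simp
    have "x = a \<or> x = b" if "x \<in> pverts G" "p x \<in> closed_segment (p a) (p b)" for x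
      using chord_Int_parabola[of "f x" "f a" "f b"] that e inj by (auto simp: p_def dest: inj_onD)
    then show "path_image (\<gamma> e) \<inter> p ` pverts G = p ` e"
      using e by auto
  next
    fix e e' assume "e \<in> uedges G" "e' \<in> uedges G" and ne: "e \<noteq> e'"
    then obtain a b c d
      where e: "(a, b) \<in> parcs G" "e = {a, b}" "a \<in> pverts G" "b \<in> pverts G" "f a < f b"
        "\<gamma> e = linepath (p a) (p b)"
      and e': "(c, d) \<in> parcs G" "e' = {c, d}" "c \<in> pverts G" "d \<in> pverts G" "f c < f d"
        "\<gamma> e' = linepath (p c) (p d)"
      by (elim edgeE)
    have ne': "(f a, f b) \<noteq> (f c, f d)"
      using ne e e' inj by (auto dest: inj_onD)
    have "{f a, f b} \<inter> {f c, f d} = f ` (e \<inter> e')"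
      using e e' inj by (subst inj_on_image_Int[of f "pverts G"]) auto
    then show "path_image (\<gamma> e) \<inter> path_image (\<gamma> e') \<subseteq> p ` (e \<inter> e')"
      using noncrossing_chords[OF _ _ e(5) e'(5) ne' nc[OF e(1) e'(1)] nc[OF e'(1) e(1)]]
      unfolding e(6) e'(6) path_image_linepath p_def by (force simp: image_image)
  qed
  have "drawing_image G p \<gamma> \<subseteq> {z. (Re z)\<^sup>2 \<le> Im z}"
  proof -
    have "p x \<in> {z. (Re z)\<^sup>2 \<le> Im z}" for x
      by (simp add: p_def parabola_def)
    then have "path_image (\<gamma> e) \<subseteq> {z. (Re z)\<^sup>2 \<le> Im z}" if "e \<in> uedges G" for e
      using that
      by (elim edgeE) (simp only: path_image_linepath closed_segment_subset convex_epigraph_square)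
    then show ?thesis
      by (auto simp: drawing_image_def p_def parabola_def)
  qed
  then have out: "- {z. (Re z)\<^sup>2 \<le> Im z} \<subseteq> outside (drawing_image G p \<gamma>)"
    by (intro outside_subset_convex convex_epigraph_square)
  have "p x \<in> frontier (outside (drawing_image G p \<gamma>))" if "x \<in> pverts G" for x
  proof -
    have "p x \<in> drawing_image G p \<gamma>"
      using that by (simp add: drawing_image_def)
    then have "p x \<notin> outside (drawing_image G p \<gamma>)"
      using outside_no_overlap by blast
    moreover have "p x \<in> closure (outside (drawing_image G p \<gamma>))"
      unfolding closure_approachable
    proof (intro allI impI)
      fix r :: real assume "0 < r"
      \<comment> \<open>Any point straight below a vertex has left the epigraph and hence lies in
        the outer face.\<close>
      define z where "z = Complex (f x) ((f x)\<^sup>2 - r / 2)"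
      have "z - p x = complex_of_real (- r / 2) * \<i>"
        by (simp add: complex_eq_iff z_def p_def parabola_def)
      then have "dist z (p x) = r / 2"
        using \<open>0 < r\<close> by (simp add: dist_norm norm_mult)
      moreover have "z \<in> - {z. (Re z)\<^sup>2 \<le> Im z}"
        using \<open>0 < r\<close> by (simp add: z_def)
      ultimately show "\<exists>y\<in>outside (drawing_image G p \<gamma>). dist y (p x) < r"
        using out \<open>0 < r\<close> by (intro bexI[of _ z]) auto
    qed
    ultimately show ?thesis
      using interior_subset by (auto simp: frontier_def)
  qed
  with drawing show ?thesis
    unfolding outerplanar_def by blast
qed

section \<open>Depth-first layout of the vertices of \<open>H\<close>\<close>

text \<open>
  Depth-first positions: an attached copy occupies the interval right after the vertex it is attached to.
\<close>

fun pos_three :: "three \<Rightarrow> nat" where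
  "pos_three One = 0" | "pos_three Two = 1" | "pos_three Three = 2"

fun pos_B :: "B_vertex \<Rightarrow> nat" where
  "pos_B (Bb One) = 0" | "pos_B (Bb Two) = 1" | "pos_B (Bb Three) = 5"
| "pos_B (Bc t) = 2 + pos_three t"
| "pos_B (Bd t) = 6 + pos_three t"

fun pos_G3 :: "G3_vertex \<Rightarrow> nat" where
  "pos_G3 (U One) = 0" | "pos_G3 (U Two) = 1" | "pos_G3 (U Three) = 11"
| "pos_G3 (BTwo b) = 2 + pos_B b"
| "pos_G3 (BThree b) = 12 + pos_B b"

fun pos_H :: "H_vertex \<Rightarrow> nat" where
  "pos_H (Center i) = 22 * pos_three i"
| "pos_H (Copy i g) = 22 * pos_three i + 1 + pos_G3 g"

lemma pos_three_less: "pos_three t < 3"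
  by (cases t) simp_all

lemma pos_three_eq_iff [simp]: "pos_three s = pos_three t \<longleftrightarrow> s = t"
  by (cases s; cases t) simp_all

lemma pos_B_less: "pos_B b < 9"
  by (cases b rule: pos_B.cases) (auto intro: less_trans[OF pos_three_less] pos_three_less)

lemma pos_B_eq_iff [simp]: "pos_B b = pos_B c \<longleftrightarrow> b = c"
proof -
  have "pos_three t \<noteq> 3" "pos_three t \<noteq> 4 + n" "4 + n \<noteq> pos_three t" for t n
    using pos_three_less[of t] by simp_all
  note [simp] = this this(2)[of _ 0, simplified]
  show ?thesis
    by (cases b rule: pos_B.cases; cases c rule: pos_B.cases) auto
qed

lemma pos_G3_less: "pos_G3 g < 21"
  by (cases g rule: pos_G3.cases) (auto intro: less_trans[OF pos_B_less] pos_B_less)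

lemma pos_G3_eq_iff [simp]: "pos_G3 g = pos_G3 h \<longleftrightarrow> g = h"
proof -
  have "pos_B b \<noteq> 9" "pos_B b \<noteq> 10 + pos_B c" "10 + pos_B b \<noteq> pos_B c" for b c
    using pos_B_less[of b] pos_B_less[of c] by simp_all
  then show ?thesis
    by (cases g rule: pos_G3.cases; cases h rule: pos_G3.cases) auto
qed

text \<open>Division by 22 recovers the block, which consists of a centre and the 21 vertices of its
  copy.\<close>

lemma pos_three_block:
  assumes "22 * pos_three s + m = 22 * pos_three t + n" "m < 22" "n < 22"
  shows "s = t \<and> m = n"
proof -
  have "(22 * pos_three s + m) div 22 = (22 * pos_three t + n) div 22"
    using assms(1) by simp
  then have "pos_three s = pos_three t"
    using assms(2,3) by (simp only: div_mult_self4)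
  then show ?thesis
    using assms(1) by simp
qed

lemma inj_pos_H: "inj pos_H"
proof (rule injI)
  fix x y assume eq: "pos_H x = pos_H y"
  show "x = y"
  proof (cases x; cases y)
    fix i j assume "x = Center i" "y = Center j"
    then show ?thesis using eq by simp
  next
    fix i j h assume "x = Center i" "y = Copy j h"
    then show ?thesis using eq pos_three_block[of i 0 j "1 + pos_G3 h"] pos_G3_less[of h] by simp
  next
    fix i g j assume "x = Copy i g" "y = Center j"
    then show ?thesis using eq pos_three_block[of i "1 + pos_G3 g" j 0] pos_G3_less[of g] by simp
  next
    fix i g j h assume "x = Copy i g" "y = Copy j h"
    then show ?thesis
      using eq pos_three_block[of i "1 + pos_G3 g" j "1 + pos_G3 h"] pos_G3_less[of g] pos_G3_less[of h]
      by simp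
  qed
qed

section \<open>Assembling noncrossing layouts from blocks\<close>

lemma noncrossing_map:
  fixes f :: "'b \<Rightarrow> nat"
  assumes "noncrossing g R" "\<And>x. f (e x) = k + g x"
  shows "noncrossing f (map_prod e e ` R)"
  using assms by (fastforce simp: noncrossing_def)

text \<open>An arc crossing one of \<open>S\<close> has an end strictly between \<open>m\<close> and
  \<open>n\<close>. The bound \<open>m\<close> stays available to \<open>R\<close> because the root
  of an attached copy sits there and also lies on the connecting edge.\<close>

lemma noncrossing_Un:
  assumes "noncrossing f R" "noncrossing f S"
    and S: "\<And>x y. (x, y) \<in> S \<Longrightarrow> {f x, f y} \<subseteq> {m..n}"
    and R: "\<And>x y. (x, y) \<in> R \<Longrightarrow> {f x, f y} \<inter> {m<..<n} = {}"
  shows "noncrossing f (R \<union> S)"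
proof -
  have "\<not> (f a < f c \<and> f c < f b \<and> f b < f d) \<and> \<not> (f c < f a \<and> f a < f d \<and> f d < f b)"
    if "(a, b) \<in> R" "(c, d) \<in> S" for a b c d
    using R[OF that(1)] S[OF that(2)] by fastforce
  then show ?thesis
    using assms(1,2) unfolding noncrossing_def by blast
qed

lemma noncrossing_B: "noncrossing pos_B B_arcs"
  unfolding noncrossing_def B_arcs_def triangle_def edge_def by simp

lemma noncrossing_G3: "noncrossing pos_G3 G3_arcs"
proof -
  \<comment> \<open>The spine keeps the root triangle and the connecting edges; the copies of
    \<open>B\<close> fill the nine positions 2 to 10 and 12 to 20.\<close>
  let ?spine = "triangle U \<union> edge (U Two) (BTwo (Bb One)) \<union> edge (U Three) (BThree (Bb One))"
  have spine: "noncrossing pos_G3 ?spine"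
    unfolding noncrossing_def triangle_def edge_def by simp
  have two: "noncrossing pos_G3 (?spine \<union> map_prod BTwo BTwo ` B_arcs)"
  proof (rule noncrossing_Un[OF spine, where m = 2 and n = 10])
    show "noncrossing pos_G3 (map_prod BTwo BTwo ` B_arcs)"
      by (rule noncrossing_map[OF noncrossing_B]) simp
    show "{pos_G3 x, pos_G3 y} \<subseteq> {2..10}" if "(x, y) \<in> map_prod BTwo BTwo ` B_arcs" for x y
      using that pos_B_less by (auto simp: less_Suc_eq_le[symmetric])
    show "{pos_G3 x, pos_G3 y} \<inter> {2<..<10} = {}" if "(x, y) \<in> ?spine" for x y
      using that by (auto simp: triangle_def edge_def)
  qed
  have "noncrossing pos_G3
    ((?spine \<union> map_prod BTwo BTwo ` B_arcs) \<union> map_prod BThree BThree ` B_arcs)"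
  proof (rule noncrossing_Un[OF two, where m = 12 and n = 20])
    show "noncrossing pos_G3 (map_prod BThree BThree ` B_arcs)"
      by (rule noncrossing_map[OF noncrossing_B]) simp
    show "{pos_G3 x, pos_G3 y} \<subseteq> {12..20}" if "(x, y) \<in> map_prod BThree BThree ` B_arcs" for x y
      using that pos_B_less by (auto simp: less_Suc_eq_le[symmetric])
    have "pos_B b \<le> 10" for b
      using pos_B_less[of b] by simp
    then show "{pos_G3 x, pos_G3 y} \<inter> {12<..<20} = {}"
      if "(x, y) \<in> ?spine \<union> map_prod BTwo BTwo ` B_arcs" for x y
      using that by (auto simp: triangle_def edge_def not_less)
  qed
  then show ?thesis
    by (simp add: G3_arcs_def Un_ac)
qed

lemma noncrossing_H: "noncrossing pos_H H_arcs"
proof -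
  let ?spine = "triangle Center \<union> (\<Union>i. edge (Center i) (Copy i (U One)))"
  let ?copy = "\<lambda>i. map_prod (Copy i) (Copy i) ` G3_arcs"
  have spine: "noncrossing pos_H ?spine"
    unfolding noncrossing_def triangle_def edge_def by (simp add: UNIV_three)
  \<comment> \<open>The copies are inserted one at a time, each into a block of its own.\<close>
  have copies: "noncrossing pos_H (?spine \<union> (\<Union>i\<in>I. ?copy i))" if "finite I" for I
    using that
  proof (induction I)
    case empty
    then show ?case using spine by simp
  next
    case (insert j I)
    let ?m = "22 * pos_three j + 1" and ?n = "22 * pos_three j + 21"
    have "noncrossing pos_H ((?spine \<union> (\<Union>i\<in>I. ?copy i)) \<union> ?copy j)"
    proof (rule noncrossing_Un[OF insert.IH, where m = ?m and n = ?n])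
      show "noncrossing pos_H (?copy j)"
        by (rule noncrossing_map[OF noncrossing_G3, where k = ?m]) simp
      show "{pos_H x, pos_H y} \<subseteq> {?m..?n}" if "(x, y) \<in> ?copy j" for x y
        using that pos_G3_less by (auto simp: less_Suc_eq_le[symmetric])
      \<comment> \<open>Strictly inside the block lie only non-root vertices of copy
        \<open>j\<close>, and no arc of the spine or of another copy ends at one of these.\<close>
      have inside: "\<exists>g. x = Copy j g \<and> g \<noteq> U One" if x: "pos_H x \<in> {?m<..<?n}" for x
      proof -
        obtain n where n: "1 < n" "n < 21" "pos_H x = 22 * pos_three j + n"
          using x by (intro that[of "pos_H x - 22 * pos_three j"]) auto
        show ?thesis
        proof (cases x)
          case (Center i)
          then show ?thesis using n pos_three_block[of i 0 j n] by simp
        next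
          case (Copy i g)
          then have "i = j \<and> 1 + pos_G3 g = n"
            using n pos_G3_less[of g] by (intro pos_three_block) simp_all
          then show ?thesis
            using Copy n(1) by auto
        qed
      qed
      show "{pos_H x, pos_H y} \<inter> {?m<..<?n} = {}" if xy: "(x, y) \<in> ?spine \<union> (\<Union>i\<in>I. ?copy i)" for x y
      proof -
        have "g = U One" if "x = Copy j g \<or> y = Copy j g" for g
          using that xy insert.hyps by (auto simp: triangle_def edge_def)
        then show ?thesis
          using inside[of x] inside[of y] by auto
      qed
    qed
    moreover have "(?spine \<union> (\<Union>i\<in>I. ?copy i)) \<union> ?copy j = ?spine \<union> (\<Union>i\<in>insert j I. ?copy i)"
      by blast
    ultimately show ?case
      by (simp only:)
  qed
  have "noncrossing pos_H (?spine \<union> (\<Union>i. ?copy i))"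
    by (rule copies) (simp add: UNIV_three)
  moreover have "H_arcs = ?spine \<union> (\<Union>i. ?copy i)"
    unfolding H_arcs_def by blast
  ultimately show ?thesis
    by (simp only:)
qed

lemma outerplanar_H: "outerplanar H"
proof (rule outerplanar_if_noncrossing[OF pair_graph_H])
  show "inj_on (\<lambda>x. real (pos_H x)) (pverts H)"
    using inj_pos_H by (auto simp: inj_on_def H_def)
  show "noncrossing (\<lambda>x. real (pos_H x)) (parcs H)"
    using noncrossing_H by (simp add: noncrossing_def H_def)
qed

subsection \<open>Packing colorings\<close>

text \<open>The reflexive closure lets a walk pause, so the \<open>n\<close>-th power describes
  walks of at most \<open>n\<close> arcs, whose cost bounds the distance.\<close>

lemma graph_dist_le_relpow:
  assumes G: "pair_wf_digraph G" and x: "x \<in> pverts G" and xy: "(x, y) \<in> ((parcs G)\<^sup>=) ^^ n"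
  shows "graph_dist G x y \<le> ereal (real n)"
proof -
  interpret pair_wf_digraph G by (rule G)
  have "\<exists>p. awalk x p y \<and> length p \<le> n"
    using xy
  proof (induction n arbitrary: y)
    case 0
    then show ?case using x by (auto intro!: exI[of _ "[]"] simp: awalk_Nil_iff)
  next
    case (Suc n)
    then obtain z p where p: "awalk x p z" "length p \<le> n" and zy: "(z, y) \<in> (parcs G)\<^sup>="
      by fastforce
    show ?case
    proof (cases "z = y")
      case True
      then show ?thesis using p by (auto intro!: exI[of _ p])
    next
      case False
      then have "(z, y) \<in> parcs G"
        using zy by simp
      then have "awalk z [(z, y)] y"
        using arc_implies_awalk[of "(z, y)"] by simp
      then show ?thesis
        using p by (intro exI[of _ "p @ [(z, y)]"]) (auto intro: awalk_appendI)
    qed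
  qed
  then obtain p where p: "awalk x p y" "length p \<le> n" by blast
  have "awalk_cost (\<lambda>_. 1) q = real (length q)" for q :: "('a \<times> 'a) list"
    by (induction q) simp_all
  then show ?thesis
    unfolding graph_dist_def
    using min_cost_le_walk_cost[OF p(1), of "\<lambda>_. 1"] p(2) by (simp add: order_trans)
qed

section \<open>Closeness by walks and spread-out sets\<close>

definition near :: "nat \<Rightarrow> H_vertex \<Rightarrow> H_vertex \<Rightarrow> bool" where
  "near n x y \<longleftrightarrow> (x, y) \<in> (H_arcs\<^sup>=) ^^ n"

lemma near_arc: "(x, y) \<in> H_arcs \<Longrightarrow> near 1 x y"
  by (simp add: near_def)

lemma near_trans: "near m x y \<Longrightarrow> near n y z \<Longrightarrow> near (m + n) x z"
  by (auto simp: near_def relpow_add)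

lemma near_triangle: "triangle t \<subseteq> H_arcs \<Longrightarrow> near 1 (t i) (t j)"
  by (cases i; cases j) (auto simp: near_def triangle_def edge_def)

lemma near_mono: "near m x y \<Longrightarrow> m \<le> n \<Longrightarrow> near n x y"
proof -
  have "near k y y" for k y
    by (induction k) (auto simp: near_def)
  then show "near m x y \<Longrightarrow> m \<le> n \<Longrightarrow> near n x y"
    using near_trans[of m x y "n - m" y] by simp
qed

text \<open>The distance condition on a class whose entry in the sequence is \<open>n\<close>,
  phrased by walks.\<close>

definition spread :: "nat \<Rightarrow> H_vertex set \<Rightarrow> bool" where
  "spread n A \<longleftrightarrow> (\<forall>x\<in>A. \<forall>y\<in>A. near n x y \<longrightarrow> x = y)"

lemma spreadD: "spread n A \<Longrightarrow> x \<in> A \<Longrightarrow> y \<in> A \<Longrightarrow> near m x y \<Longrightarrow> m \<le> n \<Longrightarrow> x = y"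
  using near_mono by (auto simp: spread_def)

lemma packing_class_spread:
  assumes V: "packing_coloring S H V" and i: "i < length S"
  shows "spread (S ! i) (V i)"
  unfolding spread_def
proof (intro ballI impI, rule ccontr)
  fix x y assume xy: "x \<in> V i" "y \<in> V i" "near (S ! i) x y" "x \<noteq> y"
  have "graph_dist H x y \<le> ereal (real (S ! i))"
    using xy(3) pair_graph_H graph_dist_le_relpow[of H x y "S ! i"]
    by (simp add: near_def H_def pair_graph_def pair_digraph_def pair_fin_digraph_def)
  moreover have "ereal (real (S ! i + 1)) \<le> graph_dist H x y"
    using V i xy by (auto simp: packing_coloring_def)
  ultimately have "ereal (real (S ! i + 1)) \<le> ereal (real (S ! i))"
    by (rule order_trans[rotated])
  then show False by simp
qed

section \<open>Two spread-out sets cannot meet every triangle\<close>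

text \<open>This is all the contradiction takes from a coloring, with \<open>A\<close> and
  \<open>C\<close> the classes for the entries 3 and 4.\<close>

locale triangle_transversal =
  fixes A C :: "H_vertex set"
  assumes A: "spread 3 A" and C: "spread 4 C"
    and hit: "triangle t \<subseteq> H_arcs \<Longrightarrow> \<exists>i. t i \<in> A \<union> C"
begin

text \<open>Every vertex of the triangle \<open>c\<close> is within 3 of every vertex of
  \<open>b\<close>, so \<open>c\<close> avoids \<open>A\<close> and has to meet \<open>C\<close>.
  The embedding \<open>e\<close> is arbitrary in order to serve all copies of
  \<open>B\<close>.\<close>

lemma B_copy:
  assumes e: "inj e" "map_prod e e ` B_arcs \<subseteq> H_arcs" and j: "e (Bb j) \<in> A"
  shows "\<exists>k. e (Bc k) \<in> C"
proof -
  have tri: "triangle (e \<circ> Bb) \<subseteq> H_arcs" "triangle (e \<circ> Bc) \<subseteq> H_arcs"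
    and arc: "(e (Bb Two), e (Bc One)) \<in> H_arcs"
    using e(2) by (auto simp: B_arcs_def triangle_def edge_def)
  have "near (1 + (1 + 1)) (e (Bb j)) (e (Bc k))" for k
    using near_triangle[OF tri(1), of j Two] near_arc[OF arc] near_triangle[OF tri(2), of One k]
    unfolding comp_def by (intro near_trans)
  then have "e (Bc k) \<notin> A" for k
    using spreadD[OF A j] e(1) by (fastforce dest: injD)
  then show ?thesis
    using hit[OF tri(2)] by auto
qed

text \<open>From the attaching vertex \<open>w\<close>, the triangle \<open>b\<close> is within 2
  and \<open>c\<close> within 4. A point of \<open>A\<close> next to or at \<open>w\<close> thus
  keeps \<open>A\<close> out of \<open>b\<close>. If \<open>w\<close> were in \<open>C\<close>, both
  triangles would avoid \<open>C\<close>; then \<open>b\<close> would meet \<open>A\<close>, against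
  \<open>B_copy\<close>.\<close>

lemma
  assumes e: "inj e" "map_prod e e ` B_arcs \<subseteq> H_arcs"
    and arc: "(w, e (Bb One)) \<in> H_arcs" and w: "w \<notin> range e"
  shows attached_A: "\<lbrakk>u \<in> A; near 1 u w; u \<notin> range e\<rbrakk> \<Longrightarrow> \<exists>k. e (Bb k) \<in> C"
    and attached_C: "w \<notin> C"
    and attached_near: "near 2 w (e (Bb k))"
proof -
  have tri: "triangle (e \<circ> Bb) \<subseteq> H_arcs" "triangle (e \<circ> Bc) \<subseteq> H_arcs"
    and arc2: "(e (Bb Two), e (Bc One)) \<in> H_arcs"
    using e(2) by (auto simp: B_arcs_def triangle_def edge_def)
  have nb: "near 2 w (e (Bb k))" for k
    using near_trans[OF near_arc[OF arc] near_triangle[OF tri(1), of One k, simplified]]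
    by (simp add: numeral_2_eq_2)
  show "near 2 w (e (Bb k))" by (rule nb)
  have nc: "near 4 w (e (Bc k))" for k
    using near_trans[OF nb[of Two] near_trans[OF near_arc[OF arc2]
        near_triangle[OF tri(2), of One k, simplified]]]
    by simp
  show "\<exists>k. e (Bb k) \<in> C" if u: "u \<in> A" "near 1 u w" "u \<notin> range e"
  proof -
    have "e (Bb k) \<notin> A" for k
      using spreadD[OF A u(1) _ near_trans[OF u(2) nb[of k]]] u(3) by auto
    then show ?thesis
      using hit[OF tri(1)] by auto
  qed
  show "w \<notin> C"
  proof
    assume "w \<in> C"
    then have "e (Bb k) \<notin> C" "e (Bc k) \<notin> C" for k
      using spreadD[OF C _ _ nb] spreadD[OF C _ _ nc] w by auto
    then show False
      using hit[OF tri(1)] B_copy[OF e] by auto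
  qed
qed

text \<open>The attached copies of \<open>B\<close> keep \<open>U Two\<close> and
  \<open>U Three\<close> out of \<open>C\<close>, so the triangle \<open>u\<close> meets
  \<open>A\<close> unless its root is in \<open>C\<close>.\<close>

lemma G3_copy:
  "(\<exists>j. Copy i (U j) \<in> A) \<and> (\<exists>g. Copy i g \<in> C \<and> near 3 (Copy i (U One)) (Copy i g)) \<or>
   Copy i (U One) \<in> C"
proof -
  have tri: "triangle (Copy i \<circ> U) \<subseteq> H_arcs"
    by (auto simp: H_arcs_def G3_arcs_def triangle_def edge_def)
  have e: "inj (Copy i \<circ> BTwo)" "inj (Copy i \<circ> BThree)"
    by (auto simp: inj_def)
  have B: "map_prod (Copy i \<circ> BTwo) (Copy i \<circ> BTwo) ` B_arcs \<subseteq> H_arcs"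
      "map_prod (Copy i \<circ> BThree) (Copy i \<circ> BThree) ` B_arcs \<subseteq> H_arcs"
    by (force simp: H_arcs_def G3_arcs_def)+
  have arc: "(Copy i (U Two), (Copy i \<circ> BTwo) (Bb One)) \<in> H_arcs"
      "(Copy i (U Three), (Copy i \<circ> BThree) (Bb One)) \<in> H_arcs"
    by (auto simp: H_arcs_def G3_arcs_def edge_def)
  have nu: "near 1 (Copy i (U j)) (Copy i (U k))" for j k
    using near_triangle[OF tri, of j k] by simp
  obtain j where j: "Copy i (U j) \<in> A \<union> C"
    using hit[OF tri] by auto
  show ?thesis
  proof (cases "Copy i (U j) \<in> A")
    case True
    \<comment> \<open>Any vertex of \<open>u\<close> is within 1 of \<open>U Two\<close>, itself
      included, so the copy at \<open>U Two\<close> serves for every \<open>j\<close>.\<close>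
    then obtain k where "Copy i (BTwo (Bb k)) \<in> C"
      using attached_A[OF e(1) B(1) arc(1) _ True nu] by auto
    moreover have "near 3 (Copy i (U One)) (Copy i (BTwo (Bb k)))"
      using near_trans[OF nu attached_near[OF e(1) B(1) arc(1), of k], of One]
      by (simp add: image_iff numeral_3_eq_3)
    ultimately show ?thesis
      using True by blast
  next
    case False
    moreover have "Copy i (U Two) \<notin> C" "Copy i (U Three) \<notin> C"
      using attached_C[OF e(1) B(1) arc(1)] attached_C[OF e(2) B(2) arc(2)] by auto
    ultimately show ?thesis
      using j by (cases j) auto
  qed
qed

lemma inconsistent: False
proof -
  have tri: "triangle Center \<subseteq> H_arcs" "triangle (Copy i \<circ> U) \<subseteq> H_arcs" for i
    by (auto simp: H_arcs_def G3_arcs_def triangle_def edge_def)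
  have arc: "(Center i, Copy i (U One)) \<in> H_arcs" "(Copy i (U One), Center i) \<in> H_arcs" for i
    by (auto simp: H_arcs_def edge_def)
  have near_root: "near 2 (Center i) (Copy j (U One))" for i j
    using near_trans[OF near_triangle[OF tri(1), of i j] near_arc[OF arc(1)]]
    by (simp add: numeral_2_eq_2)
  obtain i where "Center i \<in> A \<union> C"
    using hit[OF tri(1)] by auto
  then show False
  proof
    assume c: "Center i \<in> C"
    have "Copy i (U One) \<notin> C"
      using spreadD[OF C c _ near_root] by auto
    then obtain g where g: "Copy i g \<in> C" "near 3 (Copy i (U One)) (Copy i g)"
      using G3_copy[of i] by blast
    \<comment> \<open>The walk has length 1 + 3, exactly the bound 4 for \<open>C\<close>.\<close>
    show False
      using spreadD[OF C c g(1) near_trans[OF near_arc[OF arc(1)] g(2)]] by simp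
  next
    assume a: "Center i \<in> A"
    \<comment> \<open>Two steps reach any root and a third any vertex of its triangle, exactly the
      bound 3 for \<open>A\<close>.\<close>
    have "Copy j (U k) \<notin> A" for j k
      using spreadD[OF A a _ near_trans[OF near_root[of i j] near_triangle[OF tri(2), of j One k, simplified]]]
      by auto
    then have u: "Copy j (U One) \<in> C" for j
      using G3_copy[of j] by blast
    \<comment> \<open>The walk between two roots runs through their centres.\<close>
    have "near 3 (Copy One (U One)) (Copy Two (U One))"
      using near_trans[OF near_arc[OF arc(2)] near_root[of One Two]] by (simp add: numeral_3_eq_3)
    from spreadD[OF C u u this] show False
      by simp
  qed
qed

end

lemma not_packing_colorable_H: "\<not> packing_colorable [1, 1, 3, 4] H"
proof
  assume "packing_colorable [1, 1, 3, 4] H"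
  then obtain V where V: "packing_coloring [1, 1, 3, 4] H V"
    by (auto simp: packing_colorable_def)
  have spread: "spread 1 (V 0)" "spread 1 (V 1)" "spread 3 (V 2)" "spread 4 (V 3)"
    using packing_class_spread[OF V, of 0] packing_class_spread[OF V, of 1]
      packing_class_spread[OF V, of 2] packing_class_spread[OF V, of 3]
    by (simp_all add: numeral_2_eq_2 numeral_3_eq_3)
  have cover: "x \<in> V 0 \<or> x \<in> V 1 \<or> x \<in> V 2 \<or> x \<in> V 3" for x
  proof -
    have "x \<in> (\<Union>i<length [1, 1, 3, 4 :: nat]. V i)"
      using V by (simp only: packing_coloring_def H_def pair_pre_digraph.select_convs UNIV_I)
    then show ?thesis
      by (auto simp: less_Suc_eq numeral_eq_Suc)
  qed
  interpret triangle_transversal "V 2" "V 3"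
  proof
    fix t assume t: "triangle t \<subseteq> H_arcs"
    have ne: "t One \<noteq> t Two" "t Two \<noteq> t Three" "t One \<noteq> t Three"
      using t irrefl_H_arcs by (auto simp: triangle_def edge_def irrefl_def)
    have indep: "t i = t j" if "t i \<in> V n" "t j \<in> V n" "n \<in> {0, 1}" for i j n
      using that spreadD[OF spread(1) _ _ near_triangle[OF t]] spreadD[OF spread(2) _ _ near_triangle[OF t]]
      by auto
    \<comment> \<open>Classes 0 and 1 each hold at most one of the three distinct vertices, so some
      vertex is left for class 2 or 3.\<close>
    show "\<exists>i. t i \<in> V 2 \<union> V 3"
      using cover[of "t One"] cover[of "t Two"] cover[of "t Three"] ne indep[of _ 0] indep[of _ 1]
      by (metis Un_iff insertCI)
  qed (use spread in auto)
  show False by (rule inconsistent)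
qed

theorem claim19:
  shows "subcubic H \<and> outerplanar H \<and> \<not> packing_colorable [1, 1, 3, 4] H"
  using subcubic_H outerplanar_H not_packing_colorable_H by blast

end
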